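(* Let $(a_n)_{n\ge 0}$ and $(b_n)_{n\ge 0}$ be arbitrary sequences of real numbers, and let $(x_n)_{n\ge -3}$ be a well-defined real solution, with initial values $x_{-3},x_{-2},x_{-1},x_0$, of $$x_{n+1}=\frac{x_{n-3}\,x_n}{x_{n-2}\,(a_n+b_n x_{n-3}x_n)},\qquad n\ge 0,$$ where well-defined means that $x_{n-2}\,(a_n+b_nx_{n-3}x_n)\neq 0$ for every $n\ge 0$. Then for every integer $n\ge 0$ and every $j\in\{0,1,2,3,4,5\}$, $$x_{6n+j-3}=x_{j-3}\prod_{s=0}^{n-1}\frac{\left(\prod\limits_{k_1=0}^{6s+j-1}a_{k_1}\right)+x_{-3}x_0\sum\limits_{l=0}^{6s+j-1}\left(b_l\prod\limits_{k_2=l+1}^{6s+j-1}a_{k_2}\right)}{\left(\prod\limits_{k_1=0}^{6s+j+2}a_{k_1}\right)+x_{-3}x_0\sum\limits_{l=0}^{6s+j+2}\left(b_l\prod\limits_{k_2=l+1}^{6s+j+2}a_{k_2}\right)},$$ where, for $j=4$ and $j=5$, the prefactors $x_{j-3}$ are expressed in terms of the initial values by $$x_1=\frac{x_{-3}x_0}{x_{-2}(a_0+b_0x_{-3}x_0)},\qquad x_2=\frac{x_{-3}x_0}{x_{-1}\bigl(a_0a_1+(a_1b_0+b_1)x_{-3}x_0\bigr)}.$$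
   Context: Empty products (in particular those with upper limit smaller than the lower limit) are equal to $1$, and empty sums are equal to $0$. *)

theory Defs
  imports Complex_Main
begin

end

theory Submission
  imports Defs
begin

text \<open>
  The products \<open>y n = x (n - 3) * x n\<close> of terms three apart satisfy the Moebius recursion
  \<open>y (n + 1) = y n / (a n + b n * y n)\<close>, which is linear in the reciprocals:
  \<open>1 / y (n + 1) = b n + a n / y n\<close>. Multiplied by \<open>y 0\<close>, its solution is the numerator/denominator
  \<open>D n\<close> of the theorem (lemma \<open>affine_orbit_Suc\<close>), so \<open>y n = y 0 / D n\<close> (lemma \<open>mobius_orbit\<close>).
  Dividing two such products with a common factor gives
  \<open>x (m + 6) / x m = y (m + 6) / y (m + 3) = D (m + 3) / D (m + 6)\<close>, and iterating this
  along each residue class modulo 6 gives the closed form.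

  All divisions are legitimate because a well-defined solution never vanishes. The hypothesis
  gives this directly for indices from \<open>-2\<close> on; and if \<open>x (-3)\<close> were zero, then so would be \<open>x 1\<close>.
\<close>

text \<open>The solution of \<open>D (n + 1) = a n * D n + b n * c\<close> with \<open>D 0 = 1\<close>.\<close>
definition affine_orbit :: "(nat \<Rightarrow> 'a::comm_ring_1) \<Rightarrow> (nat \<Rightarrow> 'a) \<Rightarrow> 'a \<Rightarrow> nat \<Rightarrow> 'a" where
  "affine_orbit a b c n =
     (\<Prod>k\<in>{0..<n}. a k) + c * (\<Sum>l\<in>{0..<n}. b l * (\<Prod>k\<in>{l+1..<n}. a k))"

lemma affine_orbit_0 [simp]: "affine_orbit a b c 0 = 1"
  by (simp add: affine_orbit_def)

lemma affine_orbit_Suc: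
  "affine_orbit a b c (Suc n) = a n * affine_orbit a b c n + b n * c"
proof -
  have "(\<Sum>l\<in>{0..<n}. b l * (\<Prod>k\<in>{l+1..<Suc n}. a k))
      = (\<Sum>l\<in>{0..<n}. a n * (b l * (\<Prod>k\<in>{l+1..<n}. a k)))"
    by (intro sum.cong) (simp_all add: prod.atLeastLessThan_Suc mult_ac)
  then show ?thesis
    by (simp add: affine_orbit_def sum_distrib_left algebra_simps)
qed

text \<open>
  The linearisation, in a form free of division. From \<open>y n * D n = y 0\<close> one gets
  \<open>D (n + 1) = (a n + b n * y n) * D n\<close>, so that passing to \<open>n + 1\<close> multiplies \<open>D\<close> by exactly
  the factor by which it divides \<open>y\<close>.
\<close>
lemma mobius_orbit:
  fixes a b y :: "nat \<Rightarrow> 'a::field"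
  assumes nz: "\<And>n. a n + b n * y n \<noteq> 0"
    and rec: "\<And>n. y (Suc n) = y n / (a n + b n * y n)"
  shows "y n * affine_orbit a b (y 0) n = y 0"
proof (induction n)
  case 0
  show ?case by simp
next
  case (Suc n)
  have "affine_orbit a b (y 0) (Suc n)
      = a n * affine_orbit a b (y 0) n + b n * (y n * affine_orbit a b (y 0) n)"
    by (simp add: affine_orbit_Suc Suc.IH)
  also have "\<dots> = (a n + b n * y n) * affine_orbit a b (y 0) n"
    by (simp add: algebra_simps)
  finally show ?case
    using nz[of n] Suc.IH by (simp add: rec)
qed

theorem mainTheorem1:
  fixes a b :: "nat \<Rightarrow> real"
    and x :: "int \<Rightarrow> real"
  assumes well_defined:
      "\<And>n::nat. x (int n - 2) * (a n + b n * x (int n - 3) * x (int n)) \<noteq> 0"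
    and solution:
      "\<And>n::nat. x (int n + 1) =
         (x (int n - 3) * x (int n)) /
         (x (int n - 2) * (a n + b n * x (int n - 3) * x (int n)))"
  shows "(\<forall>n::nat. \<forall>j\<in>{0,1,2,3,4,5::nat}.
            x (6 * int n + int j - 3) =
              x (int j - 3) *
              (\<Prod>s\<in>{0..<n}.
                 ((\<Prod>k1\<in>{0..<6*s+j}. a k1) +
                    x (-3) * x 0 * (\<Sum>l\<in>{0..<6*s+j}. b l * (\<Prod>k2\<in>{l+1..<6*s+j}. a k2))) /
                 ((\<Prod>k1\<in>{0..<6*s+j+3}. a k1) +
                    x (-3) * x 0 * (\<Sum>l\<in>{0..<6*s+j+3}. b l * (\<Prod>k2\<in>{l+1..<6*s+j+3}. a k2)))))
       \<and> x 1 = (x (-3) * x 0) / (x (-2) * (a 0 + b 0 * x (-3) * x 0))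
       \<and> x 2 = (x (-3) * x 0) / (x (-1) * (a 0 * a 1 + (a 1 * b 0 + b 1) * x (-3) * x 0))"
proof -
  define y where "y n = x (int n - 3) * x (int n)" for n
  define D where "D = affine_orbit a b (y 0)"
  have x_nz: "x (int n - 2) \<noteq> 0" and den_nz: "a n + b n * y n \<noteq> 0" for n
    using well_defined[of n] by (auto simp: y_def mult.assoc)
  have sol: "x (int n + 1) = y n / (x (int n - 2) * (a n + b n * y n))" for n
    using solution[of n] by (simp add: y_def mult.assoc)

  have y_nz: "y n \<noteq> 0" for n
    \<comment> \<open>\<open>y n\<close> is the numerator of \<open>x (n + 1)\<close>, which is nonzero; this covers \<open>y 0\<close> and with it \<open>x (-3)\<close>.\<close>
    using sol[of n] x_nz[of "n + 3"] by (auto simp: add.commute)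
  have y_rec: "y (Suc n) = y n / (a n + b n * y n)" for n
    using sol[of n] x_nz[of n] by (simp add: y_def[of "Suc n"] add.commute)
  have yD: "y n * D n = y 0" for n
    unfolding D_def by (rule mobius_orbit[where a = a and b = b and y = y, OF den_nz y_rec])
  have D_nz: "D n \<noteq> 0" for n
    using yD[of n] y_nz[of 0] by auto

  have step: "x (int m + 3) = x (int m - 3) * (D m / D (m + 3))" for m
  proof -
    have "x (int m - 3) * x (int m) * D m = x (int m) * x (int m + 3) * D (m + 3)"
      using yD[of m] yD[of "m + 3"] by (simp add: y_def)
    moreover have "x (int m) \<noteq> 0"
      using y_nz[of m] by (simp add: y_def)
    ultimately show ?thesis
      using D_nz[of "m + 3"] by (simp add: field_simps)
  qed

  have closed: "x (6 * int n + int j - 3) = x (int j - 3) * (\<Prod>s\<in>{0..<n}. D (6*s+j) / D (6*s+j+3))"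
    for n j
  proof (induction n)
    case 0
    show ?case by simp
  next
    case (Suc n)
    have "x (6 * int (Suc n) + int j - 3) = x (int (6*n+j) + 3)"
      by (rule arg_cong[of _ _ x]) simp
    also have "\<dots> = x (6 * int n + int j - 3) * (D (6*n+j) / D (6*n+j+3))"
      using step[of "6*n+j"] by simp
    finally show ?case
      by (simp only: Suc.IH prod.atLeastLessThan_Suc[OF le0] mult.assoc)
  qed

  have y0: "y 0 = x (-3) * x 0"
    by (simp add: y_def)
  have x1: "x 1 = (x (-3) * x 0) / (x (-2) * (a 0 + b 0 * x (-3) * x 0))"
    using solution[of 0] by simp
  have D2: "D 2 = a 0 * a 1 + (a 1 * b 0 + b 1) * x (-3) * x 0"
    by (simp add: D_def numeral_2_eq_2 affine_orbit_Suc y0 algebra_simps)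
  have "x (-1) * x 2 * D 2 = x (-3) * x 0"
    using yD[of 2] by (simp add: y_def)
  then have x2: "x 2 = (x (-3) * x 0) / (x (-1) * D 2)"
    using x_nz[of 1] D_nz[of 2] by (simp add: field_simps)
  show ?thesis
    using closed x1 x2 unfolding D2 by (simp add: D_def affine_orbit_def y0)
qed

end
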